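(* Consider a family of densities $\{p_\theta:\theta\in\Theta\}$ on $\mathcal{X}$ along with a prior density $\pi$ on $\Theta$ and the resulting collection of single-cluster marginals $m(\cdot)$. Let $X_1,X_2,\dots\in\mathcal{X}$ be a sequence of random variables (not necessarily i.i.d.). If there exists $U\subset\mathcal{X}$ such that (1) $\displaystyle\liminf_{n\to\infty}\frac1n\sum_{j=1}^n I(X_j\in U)>0$ with probability $1$, and (2) $\displaystyle\sup\Big\{\frac{p_\theta(x)}{m(x)}:x\in U,\ \theta\in\Theta\Big\}<\infty$ (where $0/0=0$ and $y/0=\infty$ for $y>0$), then for all $t\in\{1,2,\dots\}$, $$\sup_{c\in[0,\infty)}\liminf_{n\to\infty}\phi_t(X_{1:n},c)>0\quad\text{with probability }1.$$
   Context: $\Theta\subset\mathbb{R}^k$, $\mathcal{X}\subset\mathbb{R}^d$; $\pi$ is a probability density with respect to Lebesgue measure; $\{p_\theta\}$ are probability densities with respect to a sigma-finite Borel measure $\lambda$ on $\mathcal{X}$, with $(\theta,x)\mapsto p_\theta(x)$ measurable. $I(E)$ is $1$ if $E$ is true and $0$ otherwise. For $x_1,\dots,x_n\in\mathcal{X}$, $J\subset\{1,\dots,n\}$ and $x_J=(x_j:j\in J)$, the single-cluster marginal is $$m(x_J)=\int_\Theta\Big(\prod_{j\in J}p_\theta(x_j)\Big)\pi(\theta)\,d\theta,$$ assumed finite, with $m(x_\varnothing)=1$; in particular $m(x)=\int_\Theta p_\theta(x)\pi(\theta)\,d\theta$. For $1\le t\le n$, $\mathcal{A}_t(n)$ is the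 set of ordered partitions $A=(A_1,\dots,A_t)$ of $\{1,\dots,n\}$ into $t$ nonempty disjoint sets (parts). For $c\in[0,\infty)$, $\phi_t(x_{1:n},c)=\min_{A\in\mathcal{A}_t(n)}\frac1n|S_A(x_{1:n},c)|$, where $S_A(x_{1:n},c)$ is the set of $j\in\{1,\dots,n\}$ such that the part $A_\ell$ containing $j$ satisfies $m(x_{A_\ell})\le c\,m(x_{A_\ell\smallsetminus\{j\}})\,m(x_j)$. *)

theory Defs
  imports "HOL-Probability.Probability"
begin

text \<open>
  Marginals take values in \<^typ>\<open>ennreal\<close>, whose division satisfies \<open>0 / 0 = 0\<close> and
  \<open>y / 0 = \<infinity>\<close> for \<open>y > 0\<close>. A data sequence is a function on \<^typ>\<open>nat\<close> whose values at
  indices \<open>1, 2, \<dots>\<close> are the observations; the value at \<open>0\<close> is never used.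
\<close>

definition marginal ::
    "(real^'k) set \<Rightarrow> (real^'k \<Rightarrow> real^'d \<Rightarrow> real) \<Rightarrow> (real^'k \<Rightarrow> real) \<Rightarrow>
      (nat \<Rightarrow> real^'d) \<Rightarrow> nat set \<Rightarrow> ennreal" where
  "marginal \<Theta> p \<pi> x J =
    (\<integral>\<^sup>+ \<theta>. ennreal ((\<Prod>j\<in>J. p \<theta> (x j)) * \<pi> \<theta>) \<partial>lebesgue_on \<Theta>)"

definition marginal1 ::
    "(real^'k) set \<Rightarrow> (real^'k \<Rightarrow> real^'d \<Rightarrow> real) \<Rightarrow> (real^'k \<Rightarrow> real) \<Rightarrow>
      real^'d \<Rightarrow> ennreal" where
  "marginal1 \<Theta> p \<pi> x = (\<integral>\<^sup>+ \<theta>. ennreal (p \<theta> x * \<pi> \<theta>) \<partial>lebesgue_on \<Theta>)"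

lemma marginal_singleton: "marginal \<Theta> p \<pi> x {j} = marginal1 \<Theta> p \<pi> (x j)"
  by (simp add: marginal_def marginal1_def)

lemma marginal_empty:
  assumes "(\<integral>\<^sup>+ \<theta>. ennreal (\<pi> \<theta>) \<partial>lebesgue_on \<Theta>) = 1"
  shows "marginal \<Theta> p \<pi> x {} = 1"
  using assms by (simp add: marginal_def)

text \<open>The part with index \<open>\<ell> \<in> {1, \<dots>, t}\<close> of an ordered partition is the list entry \<open>A ! (\<ell> - 1)\<close>.\<close>

definition ordered_partitions :: "nat \<Rightarrow> nat \<Rightarrow> nat set list set" where
  "ordered_partitions t n =
    {A. length A = t \<and> (\<forall>l<t. A ! l \<noteq> {}) \<and>
        (\<forall>l<t. \<forall>l'<t. l \<noteq> l' \<longrightarrow> A ! l \<inter> A ! l' = {}) \<and>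
        (\<Union>l<t. A ! l) = {1..n}}"

definition S_set ::
    "(real^'k) set \<Rightarrow> (real^'k \<Rightarrow> real^'d \<Rightarrow> real) \<Rightarrow> (real^'k \<Rightarrow> real) \<Rightarrow>
      nat \<Rightarrow> (nat \<Rightarrow> real^'d) \<Rightarrow> real \<Rightarrow> nat set list \<Rightarrow> nat set" where
  "S_set \<Theta> p \<pi> n x c A =
    {j\<in>{1..n}. \<exists>l<length A. j \<in> A ! l \<and>
       marginal \<Theta> p \<pi> x (A ! l)
         \<le> ennreal c * marginal \<Theta> p \<pi> x (A ! l - {j}) * marginal1 \<Theta> p \<pi> (x j)}"

text \<open>
  The minimum is over a nonempty finite set exactly when \<open>1 \<le> t \<le> n\<close> or \<open>t = n = 0\<close>;
  for \<open>n < t\<close> it is an unspecified real, which does not affect a limit inferior in \<open>n\<close>.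
\<close>

definition phi ::
    "(real^'k) set \<Rightarrow> (real^'k \<Rightarrow> real^'d \<Rightarrow> real) \<Rightarrow> (real^'k \<Rightarrow> real) \<Rightarrow>
      nat \<Rightarrow> nat \<Rightarrow> (nat \<Rightarrow> real^'d) \<Rightarrow> real \<Rightarrow> real" where
  "phi \<Theta> p \<pi> t n x c =
    Min ((\<lambda>A. real (card (S_set \<Theta> p \<pi> n x c A)) / real n) ` ordered_partitions t n)"

end

theory Submission
  imports Defs
begin

text \<open>
  The supremum \<open>K\<close> in the second hypothesis gives \<open>p\<^sub>\<theta>(x) \<le> K m(x)\<close> for all \<open>\<theta>\<close> and all
  \<open>x \<in> U\<close>. Whenever \<open>x\<^sub>j \<in> U\<close>, integrating this bound against the remaining factors of the
  part containing \<open>j\<close> shows \<open>j \<in> S\<^sub>A(x, K)\<close>, whatever the partition \<open>A\<close>. Hence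
  \<open>\<phi>\<^sub>t(x, K)\<close> is at least the frequency of visits to \<open>U\<close>, for every \<open>n \<ge> t\<close>.
\<close>

text \<open>The factor with index \<open>j\<close> is split off the product and replaced by its
  bound \<open>B\<close>; what remains under the integral is the integrand for
  \<open>J - {j}\<close>.\<close>

lemma marginal_le_of_bounded_density:
  assumes p_meas: "\<And>i. i \<in> J \<Longrightarrow> (\<lambda>\<theta>. p \<theta> (x i)) \<in> borel_measurable (lebesgue_on \<Theta>)"
    and prior_meas: "\<pi> \<in> borel_measurable (lebesgue_on \<Theta>)"
    and p_nonneg: "\<And>\<theta>. \<theta> \<in> \<Theta> \<Longrightarrow> 0 \<le> p \<theta> (x j)"
    and "finite J" "j \<in> J"
    and bound: "\<And>\<theta>. \<theta> \<in> \<Theta> \<Longrightarrow> ennreal (p \<theta> (x j)) \<le> B"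
  shows "marginal \<Theta> p \<pi> x J \<le> B * marginal \<Theta> p \<pi> x (J - {j})"
proof -
  have "marginal \<Theta> p \<pi> x J
      = (\<integral>\<^sup>+ \<theta>. ennreal (p \<theta> (x j) * ((\<Prod>i\<in>J - {j}. p \<theta> (x i)) * \<pi> \<theta>)) \<partial>lebesgue_on \<Theta>)"
    using assms(4,5) by (simp add: marginal_def prod.remove mult.assoc)
  also have "\<dots> \<le> (\<integral>\<^sup>+ \<theta>. B * ennreal ((\<Prod>i\<in>J - {j}. p \<theta> (x i)) * \<pi> \<theta>) \<partial>lebesgue_on \<Theta>)"
  proof (rule nn_integral_mono)
    fix \<theta> assume "\<theta> \<in> space (lebesgue_on \<Theta>)"
    then have "\<theta> \<in> \<Theta>" by (simp add: space_restrict_space)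
    then show "ennreal (p \<theta> (x j) * ((\<Prod>i\<in>J - {j}. p \<theta> (x i)) * \<pi> \<theta>))
        \<le> B * ennreal ((\<Prod>i\<in>J - {j}. p \<theta> (x i)) * \<pi> \<theta>)"
      \<comment> \<open>\<open>ennreal_mult'\<close> asks for the sign of its first factor, here
        \<open>p \<theta> (x j)\<close>.\<close>
      by (simp add: ennreal_mult' p_nonneg bound mult_right_mono)
  qed
  \<comment> \<open>Pulling \<open>B\<close>, possibly infinite, out of the integral is where
    measurability enters.\<close>
  also have "\<dots> = B * marginal \<Theta> p \<pi> x (J - {j})"
    unfolding marginal_def using p_meas prior_meas
    by (intro nn_integral_cmult measurable_compose[OF _ measurable_ennreal]
        borel_measurable_times borel_measurable_prod) auto
  finally show ?thesis .
qed

lemma finite_ordered_partitions: "finite (ordered_partitions t n)"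
proof (rule finite_subset)
  show "ordered_partitions t n \<subseteq> {A. set A \<subseteq> Pow {1..n} \<and> length A = t}"
    by (force simp: ordered_partitions_def in_set_conv_nth)
  show "finite {A. set A \<subseteq> Pow {1..n::nat} \<and> length A = t}"
    by (rule finite_lists_length_eq) simp
qed

text \<open>Together with finiteness, this makes the \<open>Min\<close> in \<open>phi\<close> a
  genuine minimum.\<close>

lemma ordered_partitions_nonempty:
  assumes "1 \<le> t" "t \<le> n"
  shows "ordered_partitions t n \<noteq> {}"
proof -
  \<comment> \<open>The parts are the singletons {1}, ..., {t-1}, then the block of all remaining
    indices, nonempty because \<open>t \<le> n\<close>.\<close>
  define A where "A l = (if l < t - 1 then {Suc l} else {t..n})" for l
  have "(\<Union>l<t. A l) = {1..n}"
  proof (intro equalityI subsetI)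
    fix j assume "j \<in> {1..n}"
    then show "j \<in> (\<Union>l<t. A l)"
      using assms by (intro UN_I[of "if j < t then j - 1 else t - 1"]) (auto simp: A_def)
  qed (use assms in \<open>auto simp: A_def split: if_splits\<close>)
  moreover have "\<forall>l<t. A l \<noteq> {}"
    using assms by (auto simp: A_def)
  moreover have "\<forall>l<t. \<forall>l'<t. l \<noteq> l' \<longrightarrow> A l \<inter> A l' = {}"
    by (auto simp: A_def)
  ultimately have "map A [0..<t] \<in> ordered_partitions t n"
    by (simp add: ordered_partitions_def)
  then show ?thesis by blast
qed

text \<open>Each quantity under the minimum counts a set that contains all visits to
  \<open>U\<close>, so the visit frequency bounds every one of them from below.\<close>

lemma le_phi_of_visits_subset_S_set:
  assumes "1 \<le> t" "t \<le> n"
    and visits: "\<And>A. A \<in> ordered_partitions t n \<Longrightarrow> {j\<in>{1..n}. x j \<in> U} \<subseteq> S_set \<Theta> p \<pi> n x c A"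
  shows "(\<Sum>j=1..n. of_bool (x j \<in> U)) / real n \<le> phi \<Theta> p \<pi> t n x c"
proof -
  have count: "(\<Sum>j=1..n. of_bool (x j \<in> U)) = real (card {j\<in>{1..n}. x j \<in> U})"
    by (simp add: of_bool_def sum.If_cases Int_def)
  have "(\<Sum>j=1..n. of_bool (x j \<in> U)) / real n \<le> real (card (S_set \<Theta> p \<pi> n x c A)) / real n"
    if "A \<in> ordered_partitions t n" for A
    unfolding count using card_mono[OF _ visits[OF that]]
    by (intro divide_right_mono of_nat_mono) (simp_all add: S_set_def)
  then show ?thesis
    unfolding phi_def
    using finite_ordered_partitions ordered_partitions_nonempty[OF assms(1,2)] by simp
qed

theorem theorem4p1:
  fixes \<Theta> :: "(real^'k) set" and \<X> :: "(real^'d) set"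
    and lam :: "(real^'d) measure"
    and p :: "real^'k \<Rightarrow> real^'d \<Rightarrow> real" and \<pi> :: "real^'k \<Rightarrow> real"
    and M :: "'w measure" and X :: "nat \<Rightarrow> 'w \<Rightarrow> real^'d"
    and U :: "(real^'d) set"
  assumes Theta_meas: "\<Theta> \<in> sets lebesgue"
    and prior_meas: "\<pi> \<in> borel_measurable (lebesgue_on \<Theta>)"
    and prior_nonneg: "\<And>\<theta>. \<theta> \<in> \<Theta> \<Longrightarrow> 0 \<le> \<pi> \<theta>"
    and prior_density: "(\<integral>\<^sup>+ \<theta>. ennreal (\<pi> \<theta>) \<partial>lebesgue_on \<Theta>) = 1"
    and lam_sets: "sets lam = sets (restrict_space borel \<X>)"
    and lam_sigma_finite: "sigma_finite_measure lam"
    and p_meas: "(\<lambda>(\<theta>, x). p \<theta> x)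
        \<in> borel_measurable (lebesgue_on \<Theta> \<Otimes>\<^sub>M restrict_space borel \<X>)"
    and p_nonneg: "\<And>\<theta> x. \<theta> \<in> \<Theta> \<Longrightarrow> x \<in> \<X> \<Longrightarrow> 0 \<le> p \<theta> x"
    and p_density: "\<And>\<theta>. \<theta> \<in> \<Theta> \<Longrightarrow> (\<integral>\<^sup>+ x. ennreal (p \<theta> x) \<partial>lam) = 1"
    and marginal_finite: "\<And>n x J. (\<forall>j\<in>{1..n}. x j \<in> \<X>) \<Longrightarrow> J \<subseteq> {1..n} \<Longrightarrow>
        marginal \<Theta> p \<pi> x J < \<infinity>"
    and M_prob: "prob_space M"
    and X_rv: "\<And>j. 1 \<le> j \<Longrightarrow> X j \<in> measurable M (restrict_space borel \<X>)"
    and U_sub: "U \<subseteq> \<X>"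
    and U_freq: "AE \<omega> in M.
        liminf (\<lambda>n. ereal ((\<Sum>j=1..n. of_bool (X j \<omega> \<in> U)) / real n)) > 0"
    and U_bound: "(SUP (x, \<theta>)\<in>U \<times> \<Theta>. ennreal (p \<theta> x) / marginal1 \<Theta> p \<pi> x) < \<infinity>"
  shows "\<forall>t\<ge>1. AE \<omega> in M.
      (SUP c\<in>{0..}. liminf (\<lambda>n. ereal (phi \<Theta> p \<pi> t n (\<lambda>j. X j \<omega>) c))) > 0"
proof (intro allI impI)
  fix t :: nat assume t: "1 \<le> t"
  define K where "K = (SUP (x, \<theta>)\<in>U \<times> \<Theta>. ennreal (p \<theta> x) / marginal1 \<Theta> p \<pi> x)"
  \<comment> \<open>\<open>phi\<close> takes a real constant; since \<open>K\<close> is finite,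
    passing to the reals loses nothing.\<close>
  define c where "c = enn2real K"
  have K: "ennreal c = K"
    using U_bound by (simp add: c_def K_def)
  have section_meas: "(\<lambda>\<theta>. p \<theta> y) \<in> borel_measurable (lebesgue_on \<Theta>)" if "y \<in> \<X>" for y
    using measurable_compose[OF measurable_Pair2' p_meas, of y] that
    by (simp add: space_restrict_space)
  have density_le: "ennreal (p \<theta> y) \<le> K * marginal1 \<Theta> p \<pi> y" if "y \<in> U" "\<theta> \<in> \<Theta>" for y \<theta>
  proof -
    \<comment> \<open>A constant sequence with \<open>J = {1}\<close> specializes the finiteness
      assumption to m(y), which allows m(y) to be cancelled below.\<close>
    have "marginal1 \<Theta> p \<pi> y < \<infinity>"
      using marginal_finite[of 1 "\<lambda>_. y" "{1}"] U_sub that by (auto simp: marginal_singleton)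
    moreover have le: "ennreal (p \<theta> y) / marginal1 \<Theta> p \<pi> y \<le> K"
      unfolding K_def using that by (intro SUP_upper2[of "(y, \<theta>)"]) auto
    \<comment> \<open>Here the convention y/0 = \<infinity> for y > 0 matters: a positive density
      over a zero marginal would make \<open>K\<close> infinite.\<close>
    moreover have "ennreal (p \<theta> y) = 0" if "marginal1 \<Theta> p \<pi> y = 0"
      using le that K by (auto simp: top_unique split: if_splits)
    ultimately show ?thesis
      using mult_right_mono[OF le, of "marginal1 \<Theta> p \<pi> y"]
      by (cases "marginal1 \<Theta> p \<pi> y = 0") (auto simp: ennreal_divide_times)
  qed
  have in_S: "{j\<in>{1..n}. x j \<in> U} \<subseteq> S_set \<Theta> p \<pi> n x c A"
    if A: "A \<in> ordered_partitions t n" and x: "\<And>j. 1 \<le> j \<Longrightarrow> x j \<in> \<X>" for n A x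
  proof
    fix j assume j: "j \<in> {j\<in>{1..n}. x j \<in> U}"
    have parts: "length A = t" "(\<Union>l<t. A ! l) = {1..n}"
      using A by (auto simp: ordered_partitions_def)
    then have "j \<in> (\<Union>l<t. A ! l)"
      using j by simp
    then obtain l where l: "l < length A" "j \<in> A ! l" "A ! l \<subseteq> {1..n}"
      using parts by blast
    \<comment> \<open>The bound is taken as B = K m(x_j), so the same \<open>c\<close> serves every
      \<open>n\<close>, every partition and every data sequence in \<X>.\<close>
    have "marginal \<Theta> p \<pi> x (A ! l)
        \<le> (K * marginal1 \<Theta> p \<pi> (x j)) * marginal \<Theta> p \<pi> x (A ! l - {j})"
    proof (rule marginal_le_of_bounded_density)
      show "(\<lambda>\<theta>. p \<theta> (x i)) \<in> borel_measurable (lebesgue_on \<Theta>)" if "i \<in> A ! l" for i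
        using that l(3) by (intro section_meas x) auto
      show "finite (A ! l)"
        using l(3) finite_subset by blast
    qed (use j l(2) x p_nonneg prior_meas density_le in auto)
    then show "j \<in> S_set \<Theta> p \<pi> n x c A"
      using j l by (auto simp: S_set_def K mult_ac)
  qed
  show "AE \<omega> in M. (SUP c\<in>{0..}. liminf (\<lambda>n. ereal (phi \<Theta> p \<pi> t n (\<lambda>j. X j \<omega>) c))) > 0"
    using U_freq AE_space
  proof eventually_elim
    case (elim \<omega>)
    have X_in: "X j \<omega> \<in> \<X>" if "1 \<le> j" for j
      using measurable_space[OF X_rv[OF that] elim(2)] by (simp add: space_restrict_space)
    have "\<forall>\<^sub>F n in sequentially. ereal ((\<Sum>j=1..n. of_bool (X j \<omega> \<in> U)) / real n)
        \<le> ereal (phi \<Theta> p \<pi> t n (\<lambda>j. X j \<omega>) c)"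
      \<comment> \<open>For n < t there are no partitions and \<open>phi\<close> is unspecified; the
        limit inferior ignores these n.\<close>
      using eventually_ge_at_top[of t]
    proof eventually_elim
      case (elim n)
      show ?case
        unfolding ereal_less_eq(3) by (rule le_phi_of_visits_subset_S_set[OF t elim in_S[OF _ X_in]])
    qed
    then have "liminf (\<lambda>n. ereal ((\<Sum>j=1..n. of_bool (X j \<omega> \<in> U)) / real n))
        \<le> liminf (\<lambda>n. ereal (phi \<Theta> p \<pi> t n (\<lambda>j. X j \<omega>) c))"
      by (rule Liminf_mono)
    also have "\<dots> \<le> (SUP c\<in>{0..}. liminf (\<lambda>n. ereal (phi \<Theta> p \<pi> t n (\<lambda>j. X j \<omega>) c)))"
      by (intro SUP_upper) (simp add: c_def)
    finally show ?case using elim(1) by simp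
  qed
qed

end
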